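(* Let $z^\star\in\mathbb{T}^n$, let $\Delta\in\mathbb{C}^{n\times n}$ be a Hermitian matrix with zero diagonal, and let $C=(z^\star)(z^\star)^H+\Delta$. Suppose that $\|\Delta\|_{\rm op}\le\frac{n^{2/3}}{32768}$ and $\|\Delta z^\star\|_\infty\le\frac{n}{24}$. Then every second-order critical point of the problem $\max_{z\in\mathbb{T}^n}z^HCz$ is a global maximizer of this problem, and the global maximizer is unique up to a global phase (i.e., any two global maximizers $\hat z,\hat z'$ satisfy $\hat z'=e^{i\theta}\hat z$ for some $\theta\in[0,2\pi)$).
   Context: $\mathbb{T}^n=\{w\in\mathbb{C}^n: |w_1|=\cdots=|w_n|=1\}$; $(\cdot)^H$ is the Hermitian transpose; $\|\cdot\|_{\rm op}$ is the operator norm. For $v\in\mathbb{C}^n$, ${\rm Diag}(v)$ is the diagonal matrix with diagonal $v$; for a matrix $M$, ${\rm diag}(M)$ is the vector of its diagonal entries. Second-order critical point: for $z\in\mathbb{T}^n$ let $S(z)=\Re\{{\rm Diag}({\rm diag}(Czz^H))\}-C$ and let $T_z\mathbb{T}^n=\{w\in\mathbb{C}^n:\Re\{w_i\bar z_i\}=0,\ i=1,\dots,n\}$ be the tangent space to $\mathbb{T}^n$ at $z$. A point $\tilde z\in\mathbb{T}^n$ is a second-order critical point of $\max_{z\in\mathbb{T}^n}z^HCz$ if it is first-order critical, i.e. $S(\tilde z)\tilde z=0$, and $w^HS(\tilde z)w\ge0$ for all $w\in T_{\tilde z}\mathbb{T}^n$. *)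

theory Defs
  imports "HOL-Analysis.Analysis"
begin

definition torus :: "(complex ^ 'n) set" where
  "torus = {w. \<forall>i. norm (w $ i) = 1}"

definition hermitian_transpose :: "complex ^ 'n ^ 'm \<Rightarrow> complex ^ 'm ^ 'n" where
  "hermitian_transpose A = (\<chi> i j. cnj (A $ j $ i))"

definition hermitian :: "complex ^ 'n ^ 'n \<Rightarrow> bool" where
  "hermitian A \<longleftrightarrow> hermitian_transpose A = A"

text \<open>The rank-one matrix \<open>u v\<^sup>H\<close>.\<close>
definition outer :: "complex ^ 'n \<Rightarrow> complex ^ 'n \<Rightarrow> complex ^ 'n ^ 'n" where
  "outer u v = (\<chi> i j. u $ i * cnj (v $ j))"

text \<open>The scalar \<open>w\<^sup>H A w\<close>.\<close>
definition qform :: "complex ^ 'n ^ 'n \<Rightarrow> complex ^ 'n \<Rightarrow> complex" where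
  "qform A w = (\<Sum>i\<in>UNIV. cnj (w $ i) * (A *v w) $ i)"

text \<open>For Hermitian \<open>A\<close>, comparing real parts of \<open>w\<^sup>H A w\<close> below loses nothing.\<close>
lemma qform_hermitian_real:
  assumes "hermitian A"
  shows "qform A w \<in> \<real>"
proof -
  have A: "cnj (A $ i $ j) = A $ j $ i" for i j
    using assms unfolding hermitian_def hermitian_transpose_def
    by (metis vec_lambda_beta)
  have "cnj (qform A w) = (\<Sum>i\<in>UNIV. \<Sum>j\<in>UNIV. w $ i * (A $ j $ i * cnj (w $ j)))"
    by (simp add: qform_def matrix_vector_mult_def A sum_distrib_left)
  also have "\<dots> = (\<Sum>j\<in>UNIV. \<Sum>i\<in>UNIV. w $ i * (A $ j $ i * cnj (w $ j)))"
    by (rule sum.swap)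
  also have "\<dots> = qform A w"
    by (simp add: qform_def matrix_vector_mult_def sum_distrib_left mult_ac)
  finally show ?thesis
    by (simp add: Reals_cnj_iff)
qed

definition Diag :: "complex ^ 'n \<Rightarrow> complex ^ 'n ^ 'n" where
  "Diag v = (\<chi> i j. if i = j then v $ i else 0)"

definition diag :: "complex ^ 'n ^ 'n \<Rightarrow> complex ^ 'n" where
  "diag M = (\<chi> i. M $ i $ i)"

definition Re_mat :: "complex ^ 'n ^ 'n \<Rightarrow> complex ^ 'n ^ 'n" where
  "Re_mat M = (\<chi> i j. complex_of_real (Re (M $ i $ j)))"

text \<open>The library's \<^const>\<open>infnorm\<close> is not used: on \<^typ>\<open>complex ^ 'n\<close> it is the
  maximum over real and imaginary parts of the entries, not over their moduli.\<close>
definition sup_norm :: "complex ^ 'n \<Rightarrow> real" where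
  "sup_norm v = Max (range (\<lambda>i. norm (v $ i)))"

definition op_norm :: "complex ^ 'n ^ 'n \<Rightarrow> real" where
  "op_norm A = onorm (\<lambda>x. A *v x)"

definition S_mat :: "complex ^ 'n ^ 'n \<Rightarrow> complex ^ 'n \<Rightarrow> complex ^ 'n ^ 'n" where
  "S_mat C z = Re_mat (Diag (diag (C ** outer z z))) - C"

definition tangent_space :: "complex ^ 'n \<Rightarrow> (complex ^ 'n) set" where
  "tangent_space z = {w. \<forall>i. Re (w $ i * cnj (z $ i)) = 0}"

definition first_order_critical :: "complex ^ 'n ^ 'n \<Rightarrow> complex ^ 'n \<Rightarrow> bool" where
  "first_order_critical C z \<longleftrightarrow> z \<in> torus \<and> S_mat C z *v z = 0"

definition second_order_critical :: "complex ^ 'n ^ 'n \<Rightarrow> complex ^ 'n \<Rightarrow> bool" where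
  "second_order_critical C z \<longleftrightarrow>
     first_order_critical C z \<and> (\<forall>w \<in> tangent_space z. Re (qform (S_mat C z) w) \<ge> 0)"

definition global_maximizer :: "complex ^ 'n ^ 'n \<Rightarrow> complex ^ 'n \<Rightarrow> bool" where
  "global_maximizer C z \<longleftrightarrow> is_arg_max (\<lambda>w. Re (qform C w)) (\<lambda>w. w \<in> torus) z"

end

(* A point z of the torus with Cz = Diag(s) z is a maximizer, unique up to phase, as soon as
   S(z) = Diag(s) - C is positive definite on the complement of z: S(z) z = 0, and on the torus the
   value of the form S(z) at w is the gap between the objective at z and at w.

   Suppose s >= 0 and |y^H z| >= n/2, where y is the signal, rotated so that t = y^H z > 0. Then
   s_i z_i = t y_i + (Delta z)_i forces |z_i - y_i| <= 2 |(Delta z)_i| / t, so |z - y| is at most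
   4 |Delta| / sqrt n. Writing Delta z = Delta y + Delta (z - y) this gives s_i >= 2n/5, while on
   the complement of z the form of C is at most (|z - y|^2 + |Delta|) |u|^2 <= n |u|^2 / 10.

   Both hypotheses hold at a second-order critical point: testing the Hessian on the single
   coordinate directions gives s_i >= 1, and testing it on the tangential projections of y and
   i y gives, after summation, 2 f(z) >= f(y) + f(z^2 conj y), hence |y^H z|^2 >= n^2/2 - 2n |Delta|.
   They hold at a global maximizer by optimality in each coordinate and f(z) >= f(y). *)

theory Submission
  imports Defs
begin

section \<open>Hermitian inner product, quadratic forms and the operator norm\<close>

definition herm_inner :: "complex ^ 'n \<Rightarrow> complex ^ 'n \<Rightarrow> complex" where
  "herm_inner u v = (\<Sum>i\<in>UNIV. cnj (u $ i) * v $ i)"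

lemma qform_eq_herm_inner: "qform A w = herm_inner w (A *v w)"
  by (simp add: qform_def herm_inner_def)

lemma herm_inner_add_left: "herm_inner (u + v) w = herm_inner u w + herm_inner v w"
  by (simp add: herm_inner_def algebra_simps sum.distrib)

lemma herm_inner_add_right: "herm_inner u (v + w) = herm_inner u v + herm_inner u w"
  by (simp add: herm_inner_def algebra_simps sum.distrib)

lemma herm_inner_diff_left: "herm_inner (u - v) w = herm_inner u w - herm_inner v w"
  by (simp add: herm_inner_def algebra_simps sum_subtractf)

lemma herm_inner_diff_right: "herm_inner u (v - w) = herm_inner u v - herm_inner u w"
  by (simp add: herm_inner_def algebra_simps sum_subtractf)

lemma herm_inner_scale_left: "herm_inner (c *s u) v = cnj c * herm_inner u v"
  by (simp add: herm_inner_def sum_distrib_left mult_ac)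

lemma herm_inner_scale_right: "herm_inner u (c *s v) = c * herm_inner u v"
  by (simp add: herm_inner_def sum_distrib_left mult_ac)

lemma herm_inner_zero_right [simp]: "herm_inner u 0 = 0"
  by (simp add: herm_inner_def)

lemma cnj_herm_inner: "cnj (herm_inner u v) = herm_inner v u"
  by (simp add: herm_inner_def mult.commute)

lemma power2_norm_vec: "(norm (u :: complex ^ 'n))\<^sup>2 = (\<Sum>i\<in>UNIV. (norm (u $ i))\<^sup>2)"
  by (simp add: norm_vec_def L2_set_def sum_nonneg)

lemma herm_inner_self: "herm_inner u u = complex_of_real ((norm u)\<^sup>2)"
  unfolding herm_inner_def power2_norm_vec of_real_sum
  by (rule sum.cong) (simp_all add: complex_norm_square[symmetric] mult.commute del: of_real_power)

lemma norm_herm_inner_le: "norm (herm_inner u v) \<le> norm u * norm v"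
proof -
  have "norm (herm_inner u v) \<le> (\<Sum>i\<in>UNIV. norm (u $ i) * norm (v $ i))"
    unfolding herm_inner_def by (rule order_trans[OF norm_sum]) (simp add: norm_mult)
  also have "\<dots> \<le> L2_set (\<lambda>i. norm (u $ i)) UNIV * L2_set (\<lambda>i. norm (v $ i)) UNIV"
    using L2_set_mult_ineq[of "\<lambda>i. norm (u $ i)" "\<lambda>i. norm (v $ i)" UNIV] by simp
  finally show ?thesis by (simp add: norm_vec_def)
qed

lemma hermitian_nth: "hermitian A \<Longrightarrow> cnj (A $ i $ j) = A $ j $ i"
  unfolding hermitian_def hermitian_transpose_def by (metis vec_lambda_beta)

lemma herm_inner_mult_right:
  assumes "hermitian A"
  shows "herm_inner u (A *v v) = herm_inner (A *v u) v"
proof -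
  have "herm_inner u (A *v v) = (\<Sum>i\<in>UNIV. \<Sum>j\<in>UNIV. cnj (u $ i) * (A $ i $ j * v $ j))"
    by (simp add: herm_inner_def matrix_vector_mult_def sum_distrib_left)
  also have "\<dots> = (\<Sum>j\<in>UNIV. \<Sum>i\<in>UNIV. cnj (u $ i) * (A $ i $ j * v $ j))"
    by (rule sum.swap)
  also have "\<dots> = herm_inner (A *v u) v"
    by (simp add: herm_inner_def matrix_vector_mult_def hermitian_nth[OF assms]
        sum_distrib_left sum_distrib_right mult_ac)
  finally show ?thesis .
qed

lemma herm_inner_axis: "herm_inner (axis i d) w = cnj d * w $ i"
  by (simp add: herm_inner_def axis_def if_distrib[of cnj] if_distrib[of "\<lambda>x. x * _"]
      cong: if_cong)

lemma matrix_vector_mult_axis: "((A :: complex ^ 'n ^ 'm) *v axis i d) $ j = A $ j $ i * d"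
  by (simp add: matrix_vector_mult_def axis_def if_distrib[of "\<lambda>x. _ * x"] cong: if_cong)

lemma bounded_linear_matrix_vector_mult:
  "bounded_linear (\<lambda>x. (A :: complex ^ 'n ^ 'm) *v x)"
  unfolding linear_conv_bounded_linear[symmetric]
  by (rule linearI)
    (simp_all add: matrix_vector_mult_def vec_eq_iff algebra_simps sum.distrib scaleR_sum_right)

lemma norm_matrix_vector_le_op_norm: "norm (A *v x) \<le> op_norm A * norm x"
  unfolding op_norm_def by (rule onorm[OF bounded_linear_matrix_vector_mult])

lemma op_norm_nonneg: "0 \<le> op_norm A"
  unfolding op_norm_def by (rule onorm_pos_le[OF bounded_linear_matrix_vector_mult])

lemma abs_Re_qform_le: "\<bar>Re (qform A w)\<bar> \<le> op_norm A * (norm w)\<^sup>2"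
proof -
  have "\<bar>Re (qform A w)\<bar> \<le> norm w * norm (A *v w)"
    unfolding qform_eq_herm_inner
    using abs_Re_le_cmod norm_herm_inner_le order_trans by blast
  also have "\<dots> \<le> norm w * (op_norm A * norm w)"
    by (intro mult_left_mono norm_matrix_vector_le_op_norm) auto
  finally show ?thesis by (simp add: power2_eq_square mult_ac)
qed

lemma outer_mult_vector: "outer u v *v w = herm_inner v w *s u"
  by (simp add: outer_def herm_inner_def matrix_vector_mult_def vec_eq_iff
      sum_distrib_left sum_distrib_right mult_ac)

lemma qform_add: "qform (A + B) w = qform A w + qform B w"
  by (simp add: qform_eq_herm_inner matrix_vector_mult_add_rdistrib herm_inner_add_right)

lemma Re_qform_outer: "Re (qform (outer u u) w) = (norm (herm_inner u w))\<^sup>2"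
proof -
  have "qform (outer u u) w = herm_inner u w * cnj (herm_inner u w)"
    by (simp add: qform_eq_herm_inner outer_mult_vector herm_inner_scale_right cnj_herm_inner)
  then show ?thesis
    by (simp add: complex_norm_square[symmetric] del: of_real_power)
qed

lemma hermitian_outer_add: "hermitian \<Delta> \<Longrightarrow> hermitian (outer u u + \<Delta>)"
  by (simp add: hermitian_def hermitian_transpose_def outer_def vec_eq_iff mult.commute)

section \<open>The torus and the quadratic form of S(z)\<close>

lemma torus_nth: "w \<in> torus \<Longrightarrow> norm (w $ i) = 1"
  by (simp add: torus_def)

lemma power2_norm_torus:
  fixes w :: "complex ^ 'n"
  shows "w \<in> torus \<Longrightarrow> (norm w)\<^sup>2 = real CARD('n)"
  by (simp add: power2_norm_vec torus_nth)

lemma norm_torus: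
  fixes w :: "complex ^ 'n"
  shows "w \<in> torus \<Longrightarrow> norm w = sqrt (real CARD('n))"
  using power2_norm_torus[of w] by (metis norm_ge_zero real_sqrt_unique)

lemma sup_norm_ge: "norm (v $ i) \<le> sup_norm v"
  unfolding sup_norm_def by (rule Max_ge) auto

lemma S_mat_mult_nth:
  "(S_mat C z *v w) $ i
     = complex_of_real (Re ((C *v z) $ i * cnj (z $ i))) * w $ i - (C *v w) $ i"
proof -
  have "Re_mat (Diag (diag (C ** outer z z))) $ i $ j
      = (if i = j then complex_of_real (Re ((C *v z) $ i * cnj (z $ i))) else 0)" for j
    by (simp add: Re_mat_def Diag_def diag_def matrix_matrix_mult_def outer_def
        matrix_vector_mult_def sum_distrib_right mult.assoc)
  then have "(Re_mat (Diag (diag (C ** outer z z))) *v w) $ i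
      = complex_of_real (Re ((C *v z) $ i * cnj (z $ i))) * w $ i"
    by (simp add: matrix_vector_mult_def if_distrib[of "\<lambda>x. x * _"] cong: if_cong)
  then show ?thesis
    by (simp add: S_mat_def matrix_vector_mult_diff_rdistrib)
qed

lemma Re_qform_S_mat:
  "Re (qform (S_mat C z) w)
     = (\<Sum>i\<in>UNIV. Re ((C *v z) $ i * cnj (z $ i)) * (norm (w $ i))\<^sup>2) - Re (qform C w)"
proof -
  have "Re (cnj (w $ i) * (complex_of_real r * w $ i)) = r * (norm (w $ i))\<^sup>2" for i r
    unfolding cmod_power2 by (simp add: power2_eq_square algebra_simps)
  then show ?thesis
    unfolding qform_def S_mat_mult_nth right_diff_distrib sum_subtractf
    by (simp only: minus_complex.sel Re_sum)
qed

text \<open>The diagonal part of \<open>S_mat C z\<close> sees only the moduli of \<open>w\<close>,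
  so on the torus it contributes the constant \<open>Re (qform C z)\<close>.\<close>

lemma Re_qform_S_mat_torus:
  assumes "w \<in> torus"
  shows "Re (qform (S_mat C z) w) = Re (qform C z) - Re (qform C w)"
  unfolding Re_qform_S_mat
  by (simp add: torus_nth[OF assms] qform_def[of C z] mult.commute)

text \<open>The cross terms of \<open>u\<close> and \<open>v\<close> enter the two values on the
  left with opposite signs.\<close>

lemma qform_parallelogram:
  "qform A (u + \<i> *s v) + qform A (u - \<i> *s v) = 2 * (qform A u + qform A v)"
  by (simp add: qform_eq_herm_inner matrix_vector_right_distrib matrix_vector_mult_diff_distrib
      vector_scalar_commute herm_inner_add_left herm_inner_add_right herm_inner_diff_left
      herm_inner_diff_right herm_inner_scale_left herm_inner_scale_right distrib_left
      right_diff_distrib mult.assoc[symmetric])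

lemma unimodular_mult_cnj: "norm x = 1 \<Longrightarrow> x * cnj x = 1"
  using complex_norm_square[of x] by simp

text \<open>Equality case of \<open>Re x \<le> norm x\<close>: no modulus is left for the imaginary
  part.\<close>

lemma eq_norm_of_Re_ge_norm:
  assumes "norm x \<le> Re x"
  shows "x = complex_of_real (norm x)"
proof -
  have "Re x = norm x" using assms complex_Re_le_cmod[of x] by simp
  moreover from this have "Im x = 0"
    using cmod_power2[of x] by simp
  ultimately show ?thesis by (simp add: complex_eq_iff)
qed

section \<open>The perturbed rank-one model and its noise bounds\<close>

locale perturbed_rank_one =
  fixes N :: real and y :: "complex ^ 'n" and \<Delta> C :: "complex ^ 'n ^ 'n"
  assumes N: "N = real CARD('n)"
    and y: "y \<in> torus"
    and herm: "hermitian \<Delta>"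
    and diag0: "diag \<Delta> = 0"
    and C: "C = outer y y + \<Delta>"
    and op: "op_norm \<Delta> \<le> N powr (2/3) / 32768"
    and sup: "sup_norm (\<Delta> *v y) \<le> N / 24"
begin

lemma N_ge_1: "1 \<le> N"
  by (simp add: N Suc_leI)

lemma norm_sq_torus: "w \<in> torus \<Longrightarrow> (norm (w :: complex ^ 'n))\<^sup>2 = N"
  by (simp add: N power2_norm_torus)

lemma op_norm_le_linear: "op_norm \<Delta> \<le> N / 32768"
proof -
  have "N powr (2/3) \<le> N powr 1" using N_ge_1 by (intro powr_mono) auto
  then show ?thesis using op N_ge_1 by simp
qed

text \<open>Squaring turns the exponent 2/3 into 4/3, which is below 3/2. The noise acting on the
  error of a fixed point is at most a multiple of
  \<open>(op_norm \<Delta>)\<^sup>2 / sqrt N\<close>, hence a small multiple of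
  \<open>N\<close>.\<close>

lemma op_norm_sq_le: "(op_norm \<Delta>)\<^sup>2 \<le> N * sqrt N / 1000"
proof -
  have "(op_norm \<Delta>)\<^sup>2 \<le> (N powr (2/3) / 32768)\<^sup>2"
    using op op_norm_nonneg by (rule power_mono)
  also have "\<dots> \<le> (N powr (2/3))\<^sup>2 / 1000"
    by (simp add: power_divide divide_left_mono)
  also have "(N powr (2/3))\<^sup>2 = N powr (4/3)"
    by (simp add: power2_eq_square powr_add[symmetric])
  also have "\<dots> \<le> N powr (1 + 1/2)"
    using N_ge_1 by (intro powr_mono) auto
  also have "\<dots> = N * sqrt N"
    unfolding powr_add using N_ge_1 by (simp add: powr_half_sqrt)
  finally show ?thesis by simp
qed

lemma C_mult: "C *v w = herm_inner y w *s y + \<Delta> *v w"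
  by (simp add: C matrix_vector_mult_add_rdistrib outer_mult_vector)

lemma Re_qform_C: "Re (qform C w) = (norm (herm_inner y w))\<^sup>2 + Re (qform \<Delta> w)"
  by (simp add: C qform_add Re_qform_outer)

lemma hermitian_C: "hermitian C"
  unfolding C by (rule hermitian_outer_add[OF herm])

lemma C_diag: "C $ i $ i = 1"
proof -
  have "\<Delta> $ i $ i = 0" using diag0 by (simp add: diag_def vec_eq_iff)
  then show ?thesis
    by (simp add: C outer_def unimodular_mult_cnj[OF torus_nth[OF y]])
qed

lemma abs_Re_qform_noise_torus:
  assumes "w \<in> torus"
  shows "\<bar>Re (qform \<Delta> w)\<bar> \<le> N\<^sup>2 / 32768"
proof -
  have "\<bar>Re (qform \<Delta> w)\<bar> \<le> op_norm \<Delta> * N"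
    using abs_Re_qform_le[of \<Delta> w] by (simp add: norm_sq_torus[OF assms])
  also have "\<dots> \<le> N / 32768 * N"
    using op_norm_le_linear N_ge_1 by (intro mult_right_mono) auto
  finally show ?thesis by (simp add: power2_eq_square)
qed

lemma Re_qform_C_torus_ge:
  assumes "w \<in> torus"
  shows "- (N\<^sup>2 / 32768) \<le> Re (qform C w)"
  using abs_Re_qform_noise_torus[OF assms] unfolding Re_qform_C
  using zero_le_power2[of "norm (herm_inner y w)"] by linarith

lemma Re_qform_C_signal_ge: "N\<^sup>2 - N\<^sup>2 / 32768 \<le> Re (qform C y)"
  using abs_Re_qform_noise_torus[OF y] unfolding Re_qform_C
  by (simp add: herm_inner_self norm_sq_torus[OF y] del: of_real_power)

section \<open>Critical points and maximizers as aligned fixed points\<close>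

text \<open>Common ground of second-order critical points and global maximizers, from which
  optimality and uniqueness are derived. With \<open>s\<close> nonnegative, \<open>z\<close> is
  fixed by normalizing each nonzero entry of \<open>C *v z\<close>.\<close>

definition aligned_fixed_point :: "complex ^ 'n \<Rightarrow> (real ^ 'n) \<Rightarrow> bool" where
  "aligned_fixed_point z s \<longleftrightarrow> z \<in> torus \<and> (\<forall>i. 0 \<le> s $ i) \<and>
     (\<forall>i. (C *v z) $ i = complex_of_real (s $ i) * z $ i) \<and> N / 2 \<le> norm (herm_inner y z)"

text \<open>The noise changes the objective by at most \<open>N\<^sup>2 / 32768\<close>, and 1/2 -
  2/32768 exceeds 1/4. The threshold is the one that the Hessian test delivers.\<close>

lemma correlation_from_objective:
  assumes "z \<in> torus" "N\<^sup>2 / 2 - N\<^sup>2 / 32768 \<le> Re (qform C z)"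
  shows "N / 2 \<le> norm (herm_inner y z)"
proof (rule power2_le_imp_le)
  show "(N / 2)\<^sup>2 \<le> (norm (herm_inner y z))\<^sup>2"
    using assms(2) abs_Re_qform_noise_torus[OF assms(1)] zero_le_power2[of N]
    unfolding Re_qform_C by (simp add: power_divide)
qed simp

lemma second_order_critical_aligned:
  assumes "second_order_critical C z"
  shows "\<exists>s. aligned_fixed_point z s"
proof -
  define s where "s i = Re ((C *v z) $ i * cnj (z $ i))" for i
  have z: "z \<in> torus" and Sz: "S_mat C z *v z = 0"
    and pos: "\<And>w. w \<in> tangent_space z \<Longrightarrow> 0 \<le> Re (qform (S_mat C z) w)"
    using assms by (auto simp: second_order_critical_def first_order_critical_def)
  have zz: "z $ i * cnj (z $ i) = 1" for i
    by (rule unimodular_mult_cnj[OF torus_nth[OF z]])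
  have eig: "(C *v z) $ i = complex_of_real (s i) * z $ i" for i
  proof -
    have "(S_mat C z *v z) $ i = 0" by (simp add: Sz)
    then show ?thesis unfolding S_mat_mult_nth s_def by simp
  qed
  have s_pos: "0 \<le> s i" for i
  proof -
    \<comment> \<open>Rotating the phase of the single entry \<open>z $ i\<close> has this velocity;
      the Hessian form there is \<open>s i\<close> minus the diagonal entry 1 of
      \<open>C\<close>.\<close>
    define w where "w = axis i (\<i> * z $ i)"
    have wz: "w $ j * cnj (z $ j) = (if j = i then \<i> else 0)" for j
      by (simp add: w_def axis_def mult.assoc zz)
    have "w \<in> tangent_space z"
      unfolding tangent_space_def mem_Collect_eq wz by simp
    then have "0 \<le> Re (qform (S_mat C z) w)" by (rule pos)
    also have "qform C w = \<i> * z $ i * cnj (\<i> * z $ i)"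
      by (simp only: w_def qform_eq_herm_inner herm_inner_axis matrix_vector_mult_axis C_diag
          mult_1 mult.commute)
    then have "qform C w = 1"
      using unimodular_mult_cnj[of "\<i> * z $ i"] by (simp only: norm_mult torus_nth[OF z] norm_ii mult_1)
    then have "Re (qform (S_mat C z) w) = s i - 1"
      unfolding Re_qform_S_mat s_def[symmetric]
      by (simp add: w_def axis_def if_distrib[of norm] if_distrib[of "\<lambda>x. x\<^sup>2"]
          if_distrib[of "\<lambda>x. _ * x"] norm_mult torus_nth[OF z] cong: if_cong)
    finally show ?thesis by simp
  qed
  \<comment> \<open>Up to sign, \<open>u\<close> and \<open>v\<close> are the tangential projections of \<open>\<i> y\<close> and \<open>y\<close>;
    \<open>u + \<i> v\<close> and \<open>u - \<i> v\<close> are again in the torus, so that the parallelogram law turns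
    the two Hessian conditions into a comparison of objective values.\<close>
  define a where "a i = cnj (y $ i) * z $ i" for i
  define u where "u = (\<chi> i. \<i> * z $ i * complex_of_real (Re (a i)))"
  define v where "v = (\<chi> i. \<i> * z $ i * complex_of_real (Im (a i)))"
  have uz: "u $ i * cnj (z $ i) = \<i> * complex_of_real (Re (a i))"
    and vz: "v $ i * cnj (z $ i) = \<i> * complex_of_real (Im (a i))" for i
    using zz[of i] by (simp_all add: u_def v_def mult_ac)
  have "u \<in> tangent_space z" "v \<in> tangent_space z"
    unfolding tangent_space_def mem_Collect_eq uz vz by simp_all
  then have "0 \<le> 2 * (Re (qform (S_mat C z) u) + Re (qform (S_mat C z) v))"
    using pos by simp
  also have "\<dots> = Re (qform (S_mat C z) (u + \<i> *s v)) + Re (qform (S_mat C z) (u - \<i> *s v))"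
    using arg_cong[OF qform_parallelogram[of "S_mat C z" u v], of Re] by simp
  also have "u - \<i> *s v = \<i> *s y"
  proof -
    have "(u - \<i> *s v) $ i = \<i> * z $ i * cnj (a i)" for i
      by (simp add: u_def v_def complex_eq_iff algebra_simps)
    then show ?thesis
      using zz by (simp add: vec_eq_iff a_def mult_ac)
  qed
  \<comment> \<open>A global phase does not change a quadratic form.\<close>
  also have "Re (qform (S_mat C z) (\<i> *s y)) = Re (qform (S_mat C z) y)"
    by (simp add: Re_qform_S_mat norm_mult qform_eq_herm_inner vector_scalar_commute
        herm_inner_scale_left herm_inner_scale_right)
  finally have ge: "0 \<le> Re (qform (S_mat C z) (u + \<i> *s v)) + Re (qform (S_mat C z) y)" .
  \<comment> \<open>This torus point has entries
    \<open>\<i> * (z $ i)\<^sup>2 * cnj (y $ i)\<close>. Its correlation with the signal is not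
    controlled, so only the lower bound by the noise is used for it.\<close>
  have "(u + \<i> *s v) $ i = \<i> * z $ i * a i" for i
    by (simp add: u_def v_def complex_eq_iff algebra_simps)
  then have uv: "u + \<i> *s v \<in> torus"
    by (simp add: torus_def norm_mult a_def torus_nth[OF z] torus_nth[OF y])
  have "N\<^sup>2 / 2 - N\<^sup>2 / 32768 \<le> Re (qform C z)"
    using ge Re_qform_C_torus_ge[OF uv] Re_qform_C_signal_ge
    by (simp add: Re_qform_S_mat_torus[OF uv] Re_qform_S_mat_torus[OF y])
  then have "aligned_fixed_point z (\<chi> i. s i)"
    using z eig s_pos correlation_from_objective[OF z] by (simp add: aligned_fixed_point_def)
  then show ?thesis ..
qed

text \<open>Since \<open>C\<close> has unit diagonal, \<open>g i\<close> is the part of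
  \<open>(C *v z) $ i\<close> that does not involve \<open>z $ i\<close>. Optimality against
  replacing \<open>z $ i\<close> by the phase of \<open>g i\<close> aligns the two, with multiplier
  \<open>norm (g i) + 1\<close>.\<close>

lemma global_maximizer_aligned:
  assumes "global_maximizer C z"
  shows "\<exists>s. aligned_fixed_point z s"
proof -
  have z: "z \<in> torus" and max: "\<And>w. w \<in> torus \<Longrightarrow> Re (qform C w) \<le> Re (qform C z)"
    using assms by (auto simp: global_maximizer_def is_arg_max_linorder)
  have zz: "z $ i * cnj (z $ i) = 1" for i
    by (rule unimodular_mult_cnj[OF torus_nth[OF z]])
  define g where "g i = (C *v z) $ i - z $ i" for i
  have g: "g i = complex_of_real (norm (g i)) * z $ i" for i
  proof (cases "g i = 0")
    case False
    define v where "v = sgn (g i)"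
    have nv: "norm v = 1" using False by (simp add: v_def norm_sgn)
    define d where "d = v - z $ i"
    define e where "e = (axis i d :: complex ^ 'n)"
    have ze: "(z + e) $ j = (if j = i then v else z $ j)" for j
      by (simp add: e_def axis_def d_def)
    then have "z + e \<in> torus"
      by (simp add: torus_def nv torus_nth[OF z])
    then have "Re (qform C (z + e)) \<le> Re (qform C z)" by (rule max)
    moreover have e_inner: "herm_inner e w = cnj d * w $ i" for w
      by (simp add: e_def herm_inner_axis)
    moreover have "(C *v e) $ i = d"
      by (simp add: e_def matrix_vector_mult_axis C_diag)
    moreover have "herm_inner z (C *v e) = cnj (herm_inner e (C *v z))"
      by (simp add: herm_inner_mult_right[OF hermitian_C] cnj_herm_inner)
    \<comment> \<open>Both \<open>v\<close> and \<open>z $ i\<close> have modulus 1, so the term quadratic in \<open>d\<close> cancels against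
      the summand \<open>z $ i\<close> of \<open>(C *v z) $ i\<close>.\<close>
    ultimately have "2 * Re (cnj d * (C *v z) $ i) + Re (cnj d * d) \<le> 0"
      by (simp add: qform_eq_herm_inner matrix_vector_right_distrib herm_inner_add_left
          herm_inner_add_right)
    moreover have "(C *v z) $ i = g i + z $ i" by (simp add: g_def)
    moreover have "2 * Re (cnj d * z $ i) + Re (cnj d * d) = 0"
    proof -
      have "2 * Re (cnj d * z $ i) + Re (cnj d * d) = (norm v)\<^sup>2 - (norm (z $ i))\<^sup>2"
        unfolding cmod_power2 by (simp add: d_def power2_eq_square algebra_simps)
      then show ?thesis by (simp add: nv torus_nth[OF z])
    qed
    ultimately have "Re (cnj d * g i) \<le> 0" by (simp add: algebra_simps)
    moreover have "cnj v * g i = complex_of_real (norm (g i))"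
    proof -
      have "cnj v * g i = (g i * cnj (g i)) / complex_of_real (norm (g i))"
        by (simp add: v_def sgn_eq)
      also have "\<dots> = complex_of_real (norm (g i))"
        using False by (simp add: complex_norm_square[symmetric] power2_eq_square)
      finally show ?thesis .
    qed
    \<comment> \<open>With \<open>d = v - z $ i\<close>, the previous inequality reads
      \<open>Re (cnj v * g i) \<le> Re (cnj (z $ i) * g i)\<close>, and its left side is
      \<open>norm (g i)\<close>.\<close>
    ultimately have "norm (cnj (z $ i) * g i) \<le> Re (cnj (z $ i) * g i)"
      by (simp add: d_def left_diff_distrib norm_mult torus_nth[OF z])
    then have "cnj (z $ i) * g i = complex_of_real (norm (g i))"
      using eq_norm_of_Re_ge_norm[of "cnj (z $ i) * g i"] by (simp add: norm_mult torus_nth[OF z])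
    then have "z $ i * cnj (z $ i) * g i = complex_of_real (norm (g i)) * z $ i"
      by (simp add: mult_ac)
    then show ?thesis by (simp add: zz)
  qed simp
  have "(C *v z) $ i = complex_of_real (norm (g i) + 1) * z $ i" for i
    using g[of i] by (simp add: g_def algebra_simps)
  moreover have "N\<^sup>2 / 2 - N\<^sup>2 / 32768 \<le> Re (qform C z)"
    using max[OF y] Re_qform_C_signal_ge zero_le_power2[of N] by linarith
  ultimately have "aligned_fixed_point z (\<chi> i. norm (g i) + 1)"
    using z correlation_from_objective[OF z] by (simp add: aligned_fixed_point_def)
  then show ?thesis ..
qed

section \<open>Distance to the signal and size of the multipliers\<close>

text \<open>The vector \<open>x\<close> is the signal rotated so that \<open>herm_inner x z\<close>
  is positive.\<close>

lemma fixed_point_estimates: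
  assumes "aligned_fixed_point z s"
  obtains x where "\<And>w. norm (herm_inner x w) = norm (herm_inner y w)"
    and "(norm (z - x))\<^sup>2 \<le> N / 50"
    and "\<And>i. 2 / 5 * N \<le> s $ i"
proof -
  have z: "z \<in> torus" and s: "\<And>i. 0 \<le> s $ i"
    and eig: "\<And>i. (C *v z) $ i = complex_of_real (s $ i) * z $ i"
    and t: "N / 2 \<le> norm (herm_inner y z)"
    using assms by (auto simp: aligned_fixed_point_def)
  define t where "t = norm (herm_inner y z)"
  define r where "r = sqrt N"
  define \<delta> where "\<delta> = op_norm \<Delta>"
  define b where "b = sgn (herm_inner y z)"
  define x where "x = b *s y"
  define e where "e = \<Delta> *v z"
  have t_pos: "0 < t" and t_ge: "N / 2 \<le> t" using t N_ge_1 by (auto simp: t_def)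
  have r: "r * r = N" "1 \<le> r" using N_ge_1 by (auto simp: r_def)
  have \<delta>: "0 \<le> \<delta>" "\<delta>\<^sup>2 \<le> N * r / 1000"
    using op_norm_nonneg op_norm_sq_le by (auto simp: \<delta>_def r_def)
  have nb: "norm b = 1" using t_pos by (simp add: b_def norm_sgn t_def)
  have nx: "norm (x $ i) = 1" for i
    by (simp add: x_def norm_mult nb torus_nth[OF y])
  have "herm_inner y z = complex_of_real t * b"
    using t_pos by (simp add: b_def sgn_eq t_def)
  then have eq: "complex_of_real (s $ i) * z $ i = complex_of_real t * x $ i + e $ i" for i
    using eig[of i] by (simp add: C_mult e_def x_def mult.assoc)
  \<comment> \<open>The two vectors compared in \<open>eq\<close> have entries of modulus
    \<open>s $ i\<close> and \<open>t\<close>, so the reverse triangle inequality applies.\<close>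
  have st: "\<bar>s $ i - t\<bar> \<le> norm (e $ i)" for i
  proof -
    have "norm (complex_of_real (s $ i) * z $ i) = s $ i"
      using s by (simp add: norm_mult torus_nth[OF z])
    moreover have "norm (complex_of_real t * x $ i) = t"
      using t_pos by (simp add: norm_mult nx)
    ultimately show ?thesis
      using norm_triangle_ineq3[of "complex_of_real (s $ i) * z $ i" "complex_of_real t * x $ i"]
      by (simp add: eq)
  qed
  define D where "D = norm (z - x)"
  have "norm (t *\<^sub>R (z - x)) \<le> norm (2 *\<^sub>R e)"
  proof (rule norm_le_componentwise_cart)
    fix i
    \<comment> \<open>The error \<open>e\<close> is paid twice, once directly and once through
      \<open>t - s $ i\<close>; hence the factor 2.\<close>
    have "(t *\<^sub>R (z - x)) $ i = complex_of_real (t - s $ i) * z $ i + e $ i"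
      unfolding vector_scaleR_component scaleR_conv_of_real[where 'a = complex]
      using eq[of i] by (simp add: algebra_simps)
    also have "norm \<dots> \<le> \<bar>t - s $ i\<bar> + norm (e $ i)"
      by (rule order_trans[OF norm_triangle_ineq]) (simp add: norm_mult torus_nth[OF z] del: of_real_diff)
    also have "\<dots> \<le> norm ((2 *\<^sub>R e) $ i)"
      using st[of i] by simp
    finally show "norm ((t *\<^sub>R (z - x)) $ i) \<le> norm ((2 *\<^sub>R e) $ i)" .
  qed
  then have "t * D \<le> 2 * norm e" using t_pos by (simp add: D_def)
  also have "norm e \<le> \<delta> * r"
    using norm_matrix_vector_le_op_norm[of \<Delta> z] by (simp add: e_def \<delta>_def r_def N norm_torus[OF z])
  finally have "t * D \<le> 2 * (\<delta> * r)" by simp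
  moreover have "N / 2 * D \<le> t * D" using t_ge by (intro mult_right_mono) (auto simp: D_def)
  ultimately have "N * D \<le> 4 * (\<delta> * r)" by simp
  then have "r * (r * D) \<le> r * (4 * \<delta>)" by (simp add: r(1)[symmetric] mult_ac)
  then have rD: "r * D \<le> 4 * \<delta>" using r(2) by simp
  have "r * (\<delta> * D) \<le> 4 * \<delta>\<^sup>2"
    using mult_left_mono[OF rD \<delta>(1)] by (simp add: power2_eq_square mult_ac)
  also have "\<dots> \<le> r * (4 * N / 1000)" using \<delta>(2) by (simp add: mult_ac)
  finally have \<delta>D: "\<delta> * D \<le> 4 * N / 1000" using r(2) by simp
  have "N * D\<^sup>2 = (r * D)\<^sup>2" by (simp add: power_mult_distrib power2_eq_square r(1))
  also have "\<dots> \<le> (4 * \<delta>)\<^sup>2" using rD r(2) by (intro power_mono) (auto simp: D_def)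
  also have "\<dots> \<le> N * (16 * r / 1000)" using \<delta>(2) by (simp add: power_mult_distrib)
  finally have "D\<^sup>2 \<le> 16 * r / 1000" using N_ge_1 by simp
  also have "r \<le> N" using r by (metis mult_le_cancel_left1 order_trans zero_le_one not_le)
  finally have D: "D\<^sup>2 \<le> N / 50" using N_ge_1 by simp
  have s_ge: "2 / 5 * N \<le> s $ i" for i
  proof -
    \<comment> \<open>The entrywise noise bound is available at \<open>y\<close> only; the remainder
      is controlled by the operator norm and the small distance \<open>D\<close>.\<close>
    have "e = b *s (\<Delta> *v y) + \<Delta> *v (z - x)"
      by (simp add: e_def x_def matrix_vector_mult_diff_distrib vector_scalar_commute)
    then have "norm (e $ i) \<le> norm ((\<Delta> *v y) $ i) + norm ((\<Delta> *v (z - x)) $ i)"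
      using norm_triangle_ineq[of "b * (\<Delta> *v y) $ i" "(\<Delta> *v (z - x)) $ i"]
      by (simp add: norm_mult nb)
    also have "\<dots> \<le> N / 24 + \<delta> * D"
    proof (rule add_mono)
      show "norm ((\<Delta> *v y) $ i) \<le> N / 24" using sup sup_norm_ge order_trans by blast
      show "norm ((\<Delta> *v (z - x)) $ i) \<le> \<delta> * D"
        using norm_matrix_vector_le_op_norm[of \<Delta> "z - x"] Finite_Cartesian_Product.norm_nth_le
        unfolding \<delta>_def D_def by (rule order_trans[rotated])
    qed
    \<comment> \<open>The margin is 1/2 - 1/24 - 4/1000 > 2/5.\<close>
    finally show ?thesis using st[of i] t_ge \<delta>D N_ge_1 by linarith
  qed
  have "norm (herm_inner x w) = norm (herm_inner y w)" for w
    by (simp add: x_def herm_inner_scale_left norm_mult nb)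
  then show ?thesis using that D[unfolded D_def] s_ge by blast
qed

section \<open>Coercivity of S(z) on the orthogonal complement of z\<close>

lemma fixed_point_certificate:
  assumes "aligned_fixed_point z s" and w: "w \<in> torus"
  shows "Re (qform C w) \<le> Re (qform C z)"
    and "Re (qform C w) = Re (qform C z) \<Longrightarrow> \<exists>a. w = a *s z"
proof -
  have z: "z \<in> torus" and eig: "\<And>i. (C *v z) $ i = complex_of_real (s $ i) * z $ i"
    using assms by (auto simp: aligned_fixed_point_def)
  have zz: "z $ i * cnj (z $ i) = 1" for i
    by (rule unimodular_mult_cnj[OF torus_nth[OF z]])
  have Cz: "(C *v z) $ i * cnj (z $ i) = complex_of_real (s $ i)" for i
    by (simp add: eig mult.assoc zz)
  obtain x where x: "\<And>w. norm (herm_inner x w) = norm (herm_inner y w)"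
    and D: "(norm (z - x))\<^sup>2 \<le> N / 50" and s: "\<And>i. 2 / 5 * N \<le> s $ i"
    using fixed_point_estimates[OF assms(1)] by blast
  \<comment> \<open>Coefficient of the orthogonal projection of \<open>w\<close> onto
    \<open>z\<close>, whose squared norm is \<open>N\<close>.\<close>
  define a where "a = herm_inner z w / complex_of_real N"
  define u where "u = w - a *s z"
  have w_eq: "w = a *s z + u" by (simp add: u_def)
  have zu: "herm_inner z u = 0"
    using N_ge_1
    by (simp add: u_def herm_inner_diff_right herm_inner_scale_right a_def herm_inner_self
        norm_sq_torus[OF z] del: of_real_power)
  have S: "(S_mat C z *v v) $ i = complex_of_real (s $ i) * v $ i - (C *v v) $ i" for v i
    unfolding S_mat_mult_nth Cz by simp
  have Sz: "S_mat C z *v z = 0"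
    by (simp add: vec_eq_iff S eig)
  \<comment> \<open>Together with \<open>Sz\<close> this removes both cross terms, so only the
    component \<open>u\<close> contributes to the gap.\<close>
  have "herm_inner z (S_mat C z *v u) = 0"
  proof -
    have "herm_inner z (C *v u) = herm_inner (C *v z) u"
      by (rule herm_inner_mult_right[OF hermitian_C])
    then show ?thesis
      by (simp add: herm_inner_def S eig right_diff_distrib sum_subtractf mult_ac)
  qed
  then have "qform (S_mat C z) w = qform (S_mat C z) u"
    by (simp add: w_eq qform_eq_herm_inner matrix_vector_right_distrib vector_scalar_commute Sz
        herm_inner_add_left herm_inner_scale_left)
  then have gap: "Re (qform C z) - Re (qform C w) = Re (qform (S_mat C z) u)"
    using Re_qform_S_mat_torus[OF w, of C z] by simp
  define K where "K = N * (norm u)\<^sup>2"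
  have K: "0 \<le> K" using N_ge_1 by (simp add: K_def)
  have "2 / 5 * K \<le> (\<Sum>i\<in>UNIV. s $ i * (norm (u $ i))\<^sup>2)"
    unfolding K_def mult.assoc[symmetric] power2_norm_vec sum_distrib_left
    by (intro sum_mono mult_right_mono s) simp
  moreover have "Re (qform C u) \<le> K / 10"
  proof -
    \<comment> \<open>As \<open>u\<close> is orthogonal to \<open>z\<close>, the rank-one part acts
      on it only through the small difference \<open>z - x\<close>.\<close>
    have "norm (herm_inner y u) = norm (herm_inner (z - x) u)"
      by (simp add: x[symmetric] herm_inner_diff_left zu)
    also have "\<dots> \<le> norm (z - x) * norm u" by (rule norm_herm_inner_le)
    finally have "(norm (herm_inner y u))\<^sup>2 \<le> (norm (z - x))\<^sup>2 * (norm u)\<^sup>2"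
      unfolding power_mult_distrib[symmetric] by (rule power_mono) simp
    also have "\<dots> \<le> N / 50 * (norm u)\<^sup>2" using D by (rule mult_right_mono) simp
    finally have "(norm (herm_inner y u))\<^sup>2 \<le> K / 50" by (simp add: K_def)
    moreover have "Re (qform \<Delta> u) \<le> K / 32768"
      using abs_Re_qform_le[of \<Delta> u] mult_right_mono[OF op_norm_le_linear zero_le_power2[of "norm u"]]
      by (simp add: K_def)
    ultimately show ?thesis using K unfolding Re_qform_C by linarith
  qed
  ultimately have coercive: "K / 10 \<le> Re (qform C z) - Re (qform C w)"
    using K unfolding gap Re_qform_S_mat Cz Re_complex_of_real by linarith
  then show "Re (qform C w) \<le> Re (qform C z)" using K by linarith
  assume "Re (qform C w) = Re (qform C z)"
  then have "K = 0" using coercive K by simp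
  then have "u = 0" using N_ge_1 by (simp add: K_def)
  then show "\<exists>a. w = a *s z" using w_eq by auto
qed

end

theorem mainTheorem8:
  fixes zstar :: "complex ^ 'n" and \<Delta> C :: "complex ^ 'n ^ 'n"
  assumes "zstar \<in> torus"
    and "hermitian \<Delta>"
    and "diag \<Delta> = 0"
    and "C = outer zstar zstar + \<Delta>"
    and "op_norm \<Delta> \<le> real CARD('n) powr (2/3) / 32768"
    and "sup_norm (\<Delta> *v zstar) \<le> real CARD('n) / 24"
  shows "(\<forall>z. second_order_critical C z \<longrightarrow> global_maximizer C z) \<and>
         (\<forall>z z'. global_maximizer C z \<and> global_maximizer C z' \<longrightarrow>
            (\<exists>\<theta>::real. 0 \<le> \<theta> \<and> \<theta> < 2 * pi \<and> z' = cis \<theta> *s z))"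
proof (intro conjI allI impI)
  interpret perturbed_rank_one "real CARD('n)" zstar \<Delta> C
    using assms by unfold_locales auto
  show "global_maximizer C z" if soc: "second_order_critical C z" for z
  proof -
    obtain s where "aligned_fixed_point z s"
      using second_order_critical_aligned[OF soc] ..
    then show ?thesis
      using fixed_point_certificate(1)
      by (auto simp: global_maximizer_def is_arg_max_linorder aligned_fixed_point_def)
  qed
  show "\<exists>\<theta>::real. 0 \<le> \<theta> \<and> \<theta> < 2 * pi \<and> z' = cis \<theta> *s z"
    if max: "global_maximizer C z \<and> global_maximizer C z'" for z z'
  proof -
    have z: "z \<in> torus" and z': "z' \<in> torus" and eq: "Re (qform C z') = Re (qform C z)"
      using max by (auto simp: global_maximizer_def is_arg_max_linorder intro: antisym)
    \<comment> \<open>One maximizer supplies the certificate and the other attains equality in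
      it.\<close>
    obtain s where "aligned_fixed_point z s"
      using global_maximizer_aligned max by blast
    then obtain a where a: "z' = a *s z"
      using fixed_point_certificate(2)[OF _ z' eq] by blast
    have "norm a = 1"
      using torus_nth[OF z'] torus_nth[OF z] by (simp add: a norm_mult)
    then obtain \<theta> where "0 \<le> \<theta>" "\<theta> < 2 * pi" "a = cis \<theta>"
      using complex_unimodular_polar by (metis cis.code)
    then show ?thesis using a by blast
  qed
qed

end
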